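(* Let $M$ be a geodesically complete Riemannian manifold, let $\eta:M\times M\to TM$ satisfy $\eta(u,v)\in T_vM$ for all $u,v\in M$, let $m$ be a positive integer, and let $h:M\to\mathbb{R}$ be a differentiable function. If $\eta$ is integrable and $dh$ is strongly invariant $\eta$-monotone of order $m$, then $h$ is strongly $\eta$-invex of order $m$.
   Context: Manifolds are $C^\infty$, modelled on a Hilbert space (finite or infinite dimensional), with Riemannian metric $\langle\cdot,\cdot\rangle_p$ and norm $\|\cdot\|_p$ on $T_pM$. The differential $dh$ is identified with the gradient vector field of $h$, so $\langle dh_v,w\rangle_v=dh_v(w)$ for $w\in T_vM$. Property (P): a (differentiable) curve $r_{u,v}:[0,1]\to M$ with $r_{u,v}(0)=v$ and $r_{u,v}(1)=u$ possesses property (P) with respect to $v,u\in M$ if $$(s-t)\,r_{u,v}'(t)=\eta(r_{u,v}(s),r_{u,v}(t))\quad\text{for all } s,t\in[0,1].$$ Integrable: $\eta$ is integrable if for all $u,v\in M$ there is at least one curve $r_{u,v}$ possessing property (P) with respect to $v,u$. Strongly invariant $\eta$-monotone of order $m$ (for a vector field $X$ on $M$): there exists $\delta>0$ such that for all $u,v\in M$, $$\langle X(v),\eta(u,v)\rangle_v+\langle X(u),\eta(v,u)\rangle_u\le-\delta\left\{\|\eta(u,v)\|_v^m+\|\eta(v,u)\|_u^m\right\}.$$ Strongly $\eta$-invex of order $m$ (for differentiable $h:M\to\mathbb{R}$): there exists $\delta>0$ such that for all $u,v\in M$, $$h(u)\ge h(v)+dh_v(\eta(u,v))+\delta\|\eta(u,v)\|_v^m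 .$$ *)

theory Defs
  imports "HOL-Analysis.Analysis"
begin

section \<open>Smooth maps between normed spaces\<close>

definition bounded_multilinear ::
  "nat \<Rightarrow> ('a::real_normed_vector list \<Rightarrow> 'b::real_normed_vector) \<Rightarrow> bool" where
  "bounded_multilinear k F \<longleftrightarrow>
     (\<forall>vs. length vs = k \<longrightarrow> (\<forall>i<k. linear (\<lambda>v. F (vs[i := v])))) \<and>
     (\<exists>B. \<forall>vs. length vs = k \<longrightarrow> norm (F vs) \<le> B * prod_list (map norm vs))"

text \<open>Infinite Frechet differentiability on an open set: \<open>D k x\<close> is the \<open>k\<close>-th derivative at \<open>x\<close>,
  a bounded \<open>k\<close>-linear map given on lists of length \<open>k\<close>, and \<open>D (Suc k)\<close> is the Frechet
  derivative of \<open>D k\<close> with respect to the operator norm of \<open>k\<close>-linear maps. Lists are used because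
  the type of the iterated derivatives would otherwise depend on \<open>k\<close>.\<close>

definition smooth_on ::
  "'a::real_normed_vector set \<Rightarrow> ('a \<Rightarrow> 'b::real_normed_vector) \<Rightarrow> bool" where
  "smooth_on S f \<longleftrightarrow> open S \<and>
     (\<exists>D :: nat \<Rightarrow> 'a \<Rightarrow> 'a list \<Rightarrow> 'b.
        (\<forall>x\<in>S. D 0 x [] = f x) \<and>
        (\<forall>k. \<forall>x\<in>S. bounded_multilinear k (D k x)) \<and>
        (\<forall>k. \<forall>x\<in>S. \<forall>e>0. \<exists>d>0. \<forall>y\<in>S. norm (y - x) < d \<longrightarrow>
           (\<forall>vs. length vs = k \<longrightarrow>
              norm (D k y vs - D k x vs - D (Suc k) x ((y - x) # vs))
                \<le> e * norm (y - x) * prod_list (map norm vs))))"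

section \<open>Hilbert manifolds and their tangent spaces\<close>

text \<open>A chart \<open>(U, \<phi>)\<close> has domain \<open>U\<close>; the values of \<open>\<phi>\<close> outside \<open>U\<close> are irrelevant.\<close>

type_synonym ('p, 'e) chart = "'p set \<times> ('p \<Rightarrow> 'e)"

text \<open>A tangent vector at \<open>p\<close> is a class of pairs (chart at \<open>p\<close>, vector of the model space), two
  pairs being equivalent if the derivative of the transition map takes one vector to the other.
  Each class contains exactly one pair for every chart at \<open>p\<close>, so it is the graph of a function
  from charts to vectors. That function is what is used here (extended by 0 to the charts that
  are not charts at \<open>p\<close>), and the vector space operations are pointwise.\<close>

type_synonym ('p, 'e) tvec = "('p, 'e) chart \<Rightarrow> 'e"

record ('p, 'e) riem =
  mtop :: "'p topology"
  atlas :: "('p, 'e) chart set"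
  metric :: "'p \<Rightarrow> ('p, 'e) tvec \<Rightarrow> ('p, 'e) tvec \<Rightarrow> real"

abbreviation points :: "('p, 'e) riem \<Rightarrow> 'p set" where
  "points M \<equiv> topspace (mtop M)"

definition charts_at :: "('p, 'e) riem \<Rightarrow> 'p \<Rightarrow> ('p, 'e) chart set" where
  "charts_at M p = {c \<in> atlas M. p \<in> fst c}"

definition chart_inv :: "('p, 'e) chart \<Rightarrow> 'e \<Rightarrow> 'p" where
  "chart_inv c = inv_into (fst c) (snd c)"

definition transition :: "('p, 'e) chart \<Rightarrow> ('p, 'e) chart \<Rightarrow> 'e \<Rightarrow> 'e" where
  "transition c d = snd d \<circ> chart_inv c"

definition is_chart :: "'p topology \<Rightarrow> ('p, 'e::topological_space) chart \<Rightarrow> bool" where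
  "is_chart T c \<longleftrightarrow> openin T (fst c) \<and> open (snd c ` fst c) \<and>
     homeomorphic_map (subtopology T (fst c)) (top_of_set (snd c ` fst c)) (snd c)"

text \<open>The atlas need not be maximal.\<close>

definition hilbert_manifold :: "('p, 'e::{real_inner, complete_space}) riem \<Rightarrow> bool" where
  "hilbert_manifold M \<longleftrightarrow> Hausdorff_space (mtop M) \<and>
     (\<forall>c\<in>atlas M. is_chart (mtop M) c) \<and>
     (\<Union>c\<in>atlas M. fst c) = points M \<and>
     (\<forall>c\<in>atlas M. \<forall>d\<in>atlas M. smooth_on (snd c ` (fst c \<inter> fst d)) (transition c d))"

definition tangent_space ::
  "('p, 'e::{real_inner, complete_space}) riem \<Rightarrow> 'p \<Rightarrow> ('p, 'e) tvec set" where
  "tangent_space M p = {\<xi>.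
     (\<forall>c\<in>charts_at M p. \<forall>d\<in>charts_at M p.
        \<xi> d = frechet_derivative (transition c d) (at (snd c p)) (\<xi> c)) \<and>
     (\<forall>c. c \<notin> charts_at M p \<longrightarrow> \<xi> c = 0)}"

definition tadd :: "('p, 'e::real_vector) tvec \<Rightarrow> ('p, 'e) tvec \<Rightarrow> ('p, 'e) tvec" where
  "tadd \<xi> \<zeta> = (\<lambda>c. \<xi> c + \<zeta> c)"

definition tscale :: "real \<Rightarrow> ('p, 'e::real_vector) tvec \<Rightarrow> ('p, 'e) tvec" where
  "tscale a \<xi> = (\<lambda>c. a *\<^sub>R \<xi> c)"

text \<open>The tangent vector at \<open>p\<close> whose component in the chart \<open>c\<close> (a chart at \<open>p\<close>) is \<open>v\<close>.\<close>

definition tvec_of ::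
  "('p, 'e::{real_inner, complete_space}) riem \<Rightarrow> ('p, 'e) chart \<Rightarrow> 'p \<Rightarrow> 'e \<Rightarrow> ('p, 'e) tvec" where
  "tvec_of M c p v = (\<lambda>d. if d \<in> charts_at M p
     then frechet_derivative (transition c d) (at (snd c p)) v else 0)"

section \<open>Riemannian metrics and geodesics\<close>

definition local_metric ::
  "('p, 'e::{real_inner, complete_space}) riem \<Rightarrow> ('p, 'e) chart \<Rightarrow> 'e \<Rightarrow> 'e \<Rightarrow> 'e \<Rightarrow> real" where
  "local_metric M c x v w = metric M (chart_inv c x)
     (tvec_of M c (chart_inv c x) v) (tvec_of M c (chart_inv c x) w)"

definition inner_product_on :: "('p, 'e::real_vector) tvec set \<Rightarrow>
    (('p, 'e) tvec \<Rightarrow> ('p, 'e) tvec \<Rightarrow> real) \<Rightarrow> bool" where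
  "inner_product_on V G \<longleftrightarrow>
     (\<forall>\<xi>\<in>V. \<forall>\<zeta>\<in>V. G \<xi> \<zeta> = G \<zeta> \<xi>) \<and>
     (\<forall>\<xi>\<in>V. \<forall>\<zeta>\<in>V. \<forall>\<theta>\<in>V. G (tadd \<xi> \<zeta>) \<theta> = G \<xi> \<theta> + G \<zeta> \<theta>) \<and>
     (\<forall>a. \<forall>\<xi>\<in>V. \<forall>\<theta>\<in>V. G (tscale a \<xi>) \<theta> = a * G \<xi> \<theta>) \<and>
     (\<forall>\<xi>\<in>V. \<xi> \<noteq> (\<lambda>c. 0) \<longrightarrow> G \<xi> \<xi> > 0)"

text \<open>On a Hilbert manifold the inner product of each tangent space is required to induce the
  topology of the model space (automatic in finite dimension); this makes the tangent spaces
  Hilbert spaces, so that Christoffel symbols and gradients exist. Smoothness is that of the local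
  representative as a map into the space of bounded bilinear forms.\<close>

definition riemannian_manifold :: "('p, 'e::{real_inner, complete_space}) riem \<Rightarrow> bool" where
  "riemannian_manifold M \<longleftrightarrow> hilbert_manifold M \<and>
     (\<forall>p\<in>points M. inner_product_on (tangent_space M p) (metric M p)) \<and>
     (\<forall>c\<in>atlas M. \<forall>x\<in>snd c ` fst c. \<exists>a>0. \<exists>b. \<forall>v.
        a * (norm v)\<^sup>2 \<le> local_metric M c x v v \<and> local_metric M c x v v \<le> b * (norm v)\<^sup>2) \<and>
     (\<forall>c\<in>atlas M. \<exists>g :: 'e \<Rightarrow> 'e \<Rightarrow>\<^sub>L 'e \<Rightarrow>\<^sub>L real.
        smooth_on (snd c ` fst c) g \<and>
        (\<forall>x\<in>snd c ` fst c. \<forall>v w. blinfun_apply (blinfun_apply (g x) v) w = local_metric M c x v w))"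

definition tnorm ::
  "('p, 'e::{real_inner, complete_space}) riem \<Rightarrow> 'p \<Rightarrow> ('p, 'e) tvec \<Rightarrow> real" where
  "tnorm M p \<xi> = sqrt (metric M p \<xi> \<xi>)"

text \<open>\<open>metric_deriv M c x y v w\<close> is the derivative at \<open>x\<close> in the direction \<open>y\<close> of
  the coefficient of the metric in the chart \<open>c\<close> at \<open>v\<close>, \<open>w\<close>.\<close>

definition metric_deriv :: "('p, 'e::{real_inner, complete_space}) riem \<Rightarrow> ('p, 'e) chart \<Rightarrow>
    'e \<Rightarrow> 'e \<Rightarrow> 'e \<Rightarrow> 'e \<Rightarrow> real" where
  "metric_deriv M c x y v w = frechet_derivative (\<lambda>z. local_metric M c z v w) (at x) y"

definition christoffel :: "('p, 'e::{real_inner, complete_space}) riem \<Rightarrow> ('p, 'e) chart \<Rightarrow>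
    'e \<Rightarrow> 'e \<Rightarrow> 'e \<Rightarrow> 'e" where
  "christoffel M c x v w = (THE z. \<forall>y. local_metric M c x z y =
     (metric_deriv M c x v w y + metric_deriv M c x w v y - metric_deriv M c x y v w) / 2)"

text \<open>A geodesic for the Levi-Civita connection on an open set of times \<open>I\<close>. By continuity, the curve
  stays in the domain of \<open>c\<close> near \<open>t\<close>, so all the derivatives below are determined.\<close>

definition geodesic_on ::
  "('p, 'e::{real_inner, complete_space}) riem \<Rightarrow> real set \<Rightarrow> (real \<Rightarrow> 'p) \<Rightarrow> bool" where
  "geodesic_on M I \<gamma> \<longleftrightarrow> continuous_map (top_of_set I) (mtop M) \<gamma> \<and>
     (\<forall>t\<in>I. \<forall>c\<in>charts_at M (\<gamma> t). let x = snd c \<circ> \<gamma>; x' = (\<lambda>s. vector_derivative x (at s)) in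
        (\<forall>\<^sub>F s in nhds t. x differentiable (at s)) \<and>
        (x' has_vector_derivative - christoffel M c (x t) (x' t) (x' t)) (at t))"

definition geodesically_complete ::
  "('p, 'e::{real_inner, complete_space}) riem \<Rightarrow> bool" where
  "geodesically_complete M \<longleftrightarrow>
     (\<forall>I \<gamma>. open I \<and> is_interval I \<and> I \<noteq> {} \<and> geodesic_on M I \<gamma> \<longrightarrow>
        (\<exists>\<sigma>. geodesic_on M UNIV \<sigma> \<and> (\<forall>t\<in>I. \<sigma> t = \<gamma> t)))"

section \<open>Differentiable curves and functions\<close>

definition differentiable_curve ::
  "('p, 'e::{real_inner, complete_space}) riem \<Rightarrow> real set \<Rightarrow> (real \<Rightarrow> 'p) \<Rightarrow> bool" where
  "differentiable_curve M I r \<longleftrightarrow> continuous_map (top_of_set I) (mtop M) r \<and>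
     (\<forall>t\<in>I. \<forall>c\<in>charts_at M (r t). (snd c \<circ> r) differentiable (at t within I))"

definition velocity :: "('p, 'e::{real_inner, complete_space}) riem \<Rightarrow> real set \<Rightarrow>
    (real \<Rightarrow> 'p) \<Rightarrow> real \<Rightarrow> ('p, 'e) tvec" where
  "velocity M I r t = (\<lambda>c. if c \<in> charts_at M (r t)
     then vector_derivative (snd c \<circ> r) (at t within I) else 0)"

definition differentiable_fun ::
  "('p, 'e::{real_inner, complete_space}) riem \<Rightarrow> ('p \<Rightarrow> real) \<Rightarrow> bool" where
  "differentiable_fun M h \<longleftrightarrow>
     (\<forall>p\<in>points M. \<forall>c\<in>charts_at M p. (h \<circ> chart_inv c) differentiable (at (snd c p)))"

text \<open>On tangent vectors at \<open>p\<close> the value does not depend on the choice of the chart at \<open>p\<close>.\<close>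

definition differential :: "('p, 'e::{real_inner, complete_space}) riem \<Rightarrow> ('p \<Rightarrow> real) \<Rightarrow>
    'p \<Rightarrow> ('p, 'e) tvec \<Rightarrow> real" where
  "differential M h p \<xi> = (let c = (SOME c. c \<in> charts_at M p)
     in frechet_derivative (h \<circ> chart_inv c) (at (snd c p)) (\<xi> c))"

definition gradient :: "('p, 'e::{real_inner, complete_space}) riem \<Rightarrow> ('p \<Rightarrow> real) \<Rightarrow>
    'p \<Rightarrow> ('p, 'e) tvec" where
  "gradient M h p = (THE \<zeta>. \<zeta> \<in> tangent_space M p \<and>
     (\<forall>\<xi>\<in>tangent_space M p. metric M p \<zeta> \<xi> = differential M h p \<xi>))"

section \<open>Invexity and monotonicity\<close>

text \<open>\<open>\<eta> u v\<close> is a tangent vector at the second argument \<open>v\<close>.\<close>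

definition tangent_bifunction :: "('p, 'e::{real_inner, complete_space}) riem \<Rightarrow>
    ('p \<Rightarrow> 'p \<Rightarrow> ('p, 'e) tvec) \<Rightarrow> bool" where
  "tangent_bifunction M \<eta> \<longleftrightarrow> (\<forall>u\<in>points M. \<forall>v\<in>points M. \<eta> u v \<in> tangent_space M v)"

definition property_P :: "('p, 'e::{real_inner, complete_space}) riem \<Rightarrow>
    ('p \<Rightarrow> 'p \<Rightarrow> ('p, 'e) tvec) \<Rightarrow> (real \<Rightarrow> 'p) \<Rightarrow> 'p \<Rightarrow> 'p \<Rightarrow> bool" where
  "property_P M \<eta> r v u \<longleftrightarrow> differentiable_curve M {0..1} r \<and> r 0 = v \<and> r 1 = u \<and>
     (\<forall>s\<in>{0..1}. \<forall>t\<in>{0..1}. tscale (s - t) (velocity M {0..1} r t) = \<eta> (r s) (r t))"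

definition integrable_bifunction :: "('p, 'e::{real_inner, complete_space}) riem \<Rightarrow>
    ('p \<Rightarrow> 'p \<Rightarrow> ('p, 'e) tvec) \<Rightarrow> bool" where
  "integrable_bifunction M \<eta> \<longleftrightarrow> (\<forall>u\<in>points M. \<forall>v\<in>points M. \<exists>r. property_P M \<eta> r v u)"

definition strongly_invariant_monotone :: "('p, 'e::{real_inner, complete_space}) riem \<Rightarrow>
    ('p \<Rightarrow> 'p \<Rightarrow> ('p, 'e) tvec) \<Rightarrow> nat \<Rightarrow> ('p \<Rightarrow> ('p, 'e) tvec) \<Rightarrow> bool" where
  "strongly_invariant_monotone M \<eta> m X \<longleftrightarrow> (\<exists>\<delta>>0. \<forall>u\<in>points M. \<forall>v\<in>points M.
     metric M v (X v) (\<eta> u v) + metric M u (X u) (\<eta> v u)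
       \<le> - \<delta> * (tnorm M v (\<eta> u v) ^ m + tnorm M u (\<eta> v u) ^ m))"

definition strongly_invex :: "('p, 'e::{real_inner, complete_space}) riem \<Rightarrow>
    ('p \<Rightarrow> 'p \<Rightarrow> ('p, 'e) tvec) \<Rightarrow> nat \<Rightarrow> ('p \<Rightarrow> real) \<Rightarrow> bool" where
  "strongly_invex M \<eta> m h \<longleftrightarrow> (\<exists>\<delta>>0. \<forall>u\<in>points M. \<forall>v\<in>points M.
     h u \<ge> h v + differential M h v (\<eta> u v) + \<delta> * tnorm M v (\<eta> u v) ^ m)"

end

(* Along a curve r with property (P) from v to u put g = h o r. Monotonicity between r s and r 0,
   divided by s, reads g' s >= g' 0 + delta * s^(m-1) * |r' 0|^m. By the mean value theorem for
   g s - g' 0 * s - (delta / m) * |r' 0|^m * s^m this gives strong invexity with constant delta / m,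
   since r' 0 = eta u v. The gradient exists by the Riesz representation theorem for the metric,
   whose Riesz vector minimises B x x - 2 f x. *)
theory Submission
  imports Defs
begin

section \<open>The Riesz representation theorem for coercive symmetric forms\<close>

text \<open>The polynomial vanishes at 0, so 0 is a minimum of it and its slope \<open>2 * q\<close>
  there must be 0.\<close>

lemma quadratic_nonneg_imp_linear_zero:
  fixes p q :: real
  assumes "\<And>t. t\<^sup>2 * p + 2 * t * q \<ge> 0"
  shows "q = 0"
proof (rule ccontr)
  assume "q \<noteq> 0"
  \<comment> \<open>At \<open>t = - (e * q)\<close> the linear term outweighs the quadratic one as
    soon as \<open>e * p < 2\<close>; this \<open>e\<close> works for either sign of
    \<open>p\<close>.\<close>
  define e where "e = 1 / (\<bar>p\<bar> + 1)"
  have e: "e > 0" "e * p \<le> 1"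
    by (auto simp: e_def field_simps)
  have "(- (e * q))\<^sup>2 * p + 2 * (- (e * q)) * q = e * q\<^sup>2 * (e * p - 2)"
    by (simp add: power2_eq_square algebra_simps)
  also have "\<dots> < 0"
    using e \<open>q \<noteq> 0\<close> by (intro mult_pos_neg) auto
  finally show False
    using assms[of "- (e * q)"] by linarith
qed

text \<open>Direct method: coercivity bounds \<open>J\<close> below and makes a minimising sequence
  Cauchy, completeness supplies a minimiser, and the vanishing first variation there is the desired
  equation.\<close>

lemma riesz_coercive:
  fixes B :: "'a::{real_inner, complete_space} \<Rightarrow> 'a \<Rightarrow> real"
  assumes B: "bounded_bilinear B" and sym: "\<And>x y. B x y = B y x"
    and a: "a > 0" and coercive: "\<And>x. a * (norm x)\<^sup>2 \<le> B x x"
    and f: "bounded_linear f"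
  obtains z where "\<And>w. B z w = f w"
proof -
  interpret B: bounded_bilinear B by fact
  interpret f: bounded_linear f by fact
  define J where "J x = B x x - 2 * f x" for x
  obtain K where K: "\<And>x. norm (f x) \<le> norm x * K"
    using f.bounded by blast
  have J_lower: "J x \<ge> - (K\<^sup>2 / a)" for x
  proof -
    \<comment> \<open>Completing the square in \<open>norm x\<close>.\<close>
    have "0 \<le> (a * norm x - K)\<^sup>2 / a"
      using a by simp
    also have "\<dots> = a * (norm x)\<^sup>2 - 2 * (norm x * K) + K\<^sup>2 / a"
      using a by (simp add: field_simps power2_eq_square)
    also have "\<dots> \<le> J x + K\<^sup>2 / a"
      using coercive[of x] K[of x] unfolding J_def by simp
    finally show ?thesis by simp
  qed
  define I where "I = Inf (range J)"
  have bdd: "bdd_below (range J)"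
    using J_lower by (auto intro!: bdd_belowI2)
  have I_le: "I \<le> J x" for x
    unfolding I_def by (rule cInf_lower[OF _ bdd]) simp
  have "\<exists>x. J x < I + 1 / Suc n" for n
  proof -
    have "Inf (range J) < I + 1 / Suc n" by (simp add: I_def)
    then show ?thesis
      using cInf_less_iff[OF _ bdd] by auto
  qed
  then obtain X where X: "\<And>n. J (X n) < I + 1 / Suc n" by metis
  have parallelogram: "a * (norm (x - y))\<^sup>2 \<le> 2 * (J x - I) + 2 * (J y - I)" for x y
  proof -
    \<comment> \<open>Parallelogram law for \<open>B\<close>; the contributions of \<open>f\<close>
      cancel at the midpoint, where \<open>J\<close> is still at least \<open>I\<close>.\<close>
    have "2 * J x + 2 * J y - 4 * J ((1/2) *\<^sub>R (x + y)) = B (x - y) (x - y)"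
      unfolding J_def
      by (simp add: B.add_left B.add_right B.diff_left B.diff_right B.scaleR_left B.scaleR_right
          f.add f.scaleR sym[of y x] algebra_simps)
    then show ?thesis
      using coercive[of "x - y"] I_le[of "(1/2) *\<^sub>R (x + y)"] by simp
  qed
  have "Cauchy X"
  proof (rule CauchyI)
    fix e :: real
    assume e: "e > 0"
    \<comment> \<open>If both values of \<open>J\<close> exceed \<open>I\<close> by less than
      \<open>q\<close>, the parallelogram bound is below
      \<open>4 * q = a * e\<^sup>2\<close>.\<close>
    define q where "q = a * e\<^sup>2 / 4"
    have q: "q > 0" "4 * q = a * e\<^sup>2"
      using a e by (auto simp: q_def)
    obtain N :: nat where N: "N > 0" "1 / N < q"
      using ex_inverse_of_nat_less[OF q(1)] by (auto simp: inverse_eq_divide)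
    have small: "J (X n) - I < q" if "n \<ge> N" for n
    proof -
      have "1 / Suc n \<le> 1 / N"
        using that N by (intro divide_left_mono) auto
      then show ?thesis using X[of n] N by linarith
    qed
    show "\<exists>M. \<forall>k\<ge>M. \<forall>n\<ge>M. norm (X k - X n) < e"
    proof (intro exI allI impI)
      fix k n
      assume kn: "k \<ge> N" "n \<ge> N"
      note parallelogram[of "X k" "X n"]
      also have "2 * (J (X k) - I) + 2 * (J (X n) - I) < 4 * q"
        using small[OF kn(1)] small[OF kn(2)] by simp
      finally have "a * (norm (X k - X n))\<^sup>2 < a * e\<^sup>2"
        by (simp only: q)
      then have "(norm (X k - X n))\<^sup>2 < e\<^sup>2" using a by simp
      then show "norm (X k - X n) < e"
        using e by (meson less_imp_le power_less_imp_less_base)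
    qed
  qed
  then obtain z where z: "X \<longlonglongrightarrow> z"
    using Cauchy_convergent convergent_def by blast
  have "(\<lambda>n. J (X n)) \<longlonglongrightarrow> J z"
    unfolding J_def by (intro tendsto_intros B.tendsto f.tendsto z)
  moreover have "(\<lambda>n. I + 1 / Suc n) \<longlonglongrightarrow> I + 0"
    by (intro tendsto_intros LIMSEQ_Suc[OF lim_1_over_n])
  ultimately have "J z \<le> I + 0"
    using X by (intro LIMSEQ_le) (auto intro: less_imp_le)
  then have min: "J z \<le> J x" for x
    using I_le[of x] by simp
  have "B z w = f w" for w
  proof -
    \<comment> \<open>The left side is \<open>J (z + t *\<^sub>R w) - J z\<close>.\<close>
    have "t\<^sup>2 * B w w + 2 * t * (B z w - f w) \<ge> 0" for t
      using min[of "z + t *\<^sub>R w"] unfolding J_def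
      by (simp add: B.add_left B.add_right B.scaleR_left B.scaleR_right
          f.add f.scaleR sym[of w z] algebra_simps power2_eq_square)
    from quadratic_nonneg_imp_linear_zero[OF this] show ?thesis by simp
  qed
  then show thesis using that by blast
qed

section \<open>Charts and tangent spaces\<close>

text \<open>The clause for \<open>k = 0\<close> of the definition is Frechet differentiability, with
  derivative \<open>D 1\<close> on one-element lists.\<close>

lemma smooth_on_imp_differentiable:
  assumes "smooth_on S f" and x: "x \<in> S"
  shows "f differentiable (at x)"
proof -
  from assms obtain D where S: "open S" and D0: "\<forall>x\<in>S. D 0 x [] = f x"
    and ml: "\<forall>k. \<forall>x\<in>S. bounded_multilinear k (D k x)"
    and D: "\<forall>k. \<forall>x\<in>S. \<forall>e>0. \<exists>d>0. \<forall>y\<in>S. norm (y - x) < d \<longrightarrow>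
           (\<forall>vs. length vs = k \<longrightarrow>
              norm (D k y vs - D k x vs - D (Suc k) x ((y - x) # vs))
                \<le> e * norm (y - x) * prod_list (map norm vs))"
    unfolding smooth_on_def by blast
  let ?L = "\<lambda>v. D (Suc 0) x [v]"
  have ml1: "bounded_multilinear (Suc 0) (D (Suc 0) x)"
    using ml x by blast
  \<comment> \<open>Replacing entry 0 of \<open>[0]\<close> by \<open>v\<close> gives
    \<open>[v]\<close>, so linearity in the only slot is linearity of \<open>?L\<close>.\<close>
  have lin: "linear ?L"
    using ml1[unfolded bounded_multilinear_def, THEN conjunct1, rule_format, of "[0]" 0] by simp
  obtain C where C: "\<And>vs. length vs = Suc 0 \<Longrightarrow>
      norm (D (Suc 0) x vs) \<le> C * prod_list (map norm vs)"
    using ml1 unfolding bounded_multilinear_def by blast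
  have "norm (?L v) \<le> norm v * C" for v
    using C[of "[v]"] by (simp add: mult.commute)
  then have bl: "bounded_linear ?L"
    using lin by (intro bounded_linear.intro) (auto simp: bounded_linear_axioms_def)
  have "(f has_derivative ?L) (at x within S)"
    unfolding has_derivative_within_alt
  proof (intro conjI allI impI bl)
    fix e :: real
    assume "e > 0"
    then obtain d where "d > 0" and d: "\<And>y vs. y \<in> S \<Longrightarrow> norm (y - x) < d \<Longrightarrow> length vs = 0 \<Longrightarrow>
        norm (D 0 y vs - D 0 x vs - D (Suc 0) x ((y - x) # vs))
          \<le> e * norm (y - x) * prod_list (map norm vs)"
      using D x by meson
    \<comment> \<open>The only list of length 0 is \<open>[]\<close>, whose product of norms is
      1.\<close>
    show "\<exists>d>0. \<forall>y\<in>S. norm (y - x) < d \<longrightarrow> norm (f y - f x - ?L (y - x)) \<le> e * norm (y - x)"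
      using \<open>d > 0\<close> d[where vs = "[]"] D0 x by auto
  qed
  then show ?thesis
    using at_within_open[OF x S] unfolding differentiable_def by metis
qed

lemma charts_atD:
  assumes "c \<in> charts_at M p"
  shows "c \<in> atlas M" and "p \<in> fst c"
  using assms by (auto simp: charts_at_def)

context
  fixes M :: "('p, 'e::{real_inner, complete_space}) riem"
  assumes manifold: "hilbert_manifold M"
begin

section \<open>Charts and derivatives of transition maps\<close>

lemma chart_at_exists:
  assumes "p \<in> points M"
  obtains c where "c \<in> charts_at M p"
  using assms manifold unfolding hilbert_manifold_def charts_at_def by blast

lemma openin_chart_domain:
  assumes "c \<in> atlas M"
  shows "openin (mtop M) (fst c)"
  using assms manifold by (auto simp: hilbert_manifold_def is_chart_def)

lemma chart_inv_chart:
  assumes c: "c \<in> atlas M" and "p \<in> fst c"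
  shows "chart_inv c (snd c p) = p"
proof -
  have "homeomorphic_map (subtopology (mtop M) (fst c)) (top_of_set (snd c ` fst c)) (snd c)"
    using c manifold by (auto simp: hilbert_manifold_def is_chart_def)
  then have "inj_on (snd c) (topspace (subtopology (mtop M) (fst c)))"
    by (simp add: homeomorphic_eq_everything_map)
  moreover have "topspace (subtopology (mtop M) (fst c)) = fst c"
    using openin_subset[OF openin_chart_domain[OF c]] by auto
  ultimately show ?thesis
    using assms(2) by (simp add: chart_inv_def)
qed

lemma transition_chart:
  assumes "c \<in> atlas M" and "p \<in> fst c"
  shows "transition c d (snd c p) = snd d p"
  using chart_inv_chart[OF assms] by (simp add: transition_def)

lemma smooth_transition:
  assumes "c \<in> atlas M" and "d \<in> atlas M"
  shows "smooth_on (snd c ` (fst c \<inter> fst d)) (transition c d)"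
  using assms manifold by (auto simp: hilbert_manifold_def)

lemma transition_has_derivative:
  assumes "c \<in> charts_at M p" and "d \<in> charts_at M p"
  shows "(transition c d has_derivative frechet_derivative (transition c d) (at (snd c p)))
    (at (snd c p))"
  using smooth_on_imp_differentiable[OF smooth_transition[of c d], of "snd c p"] assms
  by (auto simp: charts_at_def frechet_derivative_works)

lemma linear_frechet_transition:
  assumes "c \<in> charts_at M p" and "d \<in> charts_at M p"
  shows "linear (frechet_derivative (transition c d) (at (snd c p)))"
  using transition_has_derivative[OF assms] by (rule has_derivative_linear)

text \<open>Chain rule: changing from \<open>c\<close> to \<open>d\<close> and then to
  \<open>e\<close> is changing from \<open>c\<close> to \<open>e\<close>, on the open image of the
  overlap of \<open>c\<close> and \<open>d\<close>.\<close>

lemma frechet_transition_cocycle: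
  assumes c: "c \<in> charts_at M p" and d: "d \<in> charts_at M p" and e: "e \<in> charts_at M p"
  shows "frechet_derivative (transition d e) (at (snd d p))
      (frechet_derivative (transition c d) (at (snd c p)) v) =
    frechet_derivative (transition c e) (at (snd c p)) v"
proof -
  note cd = charts_atD[OF c] charts_atD[OF d]
  let ?S = "snd c ` (fst c \<inter> fst d)"
  have S: "open ?S" "snd c p \<in> ?S"
    using smooth_transition[of c d] cd by (auto simp: smooth_on_def)
  have "((transition d e \<circ> transition c d) has_derivative
      frechet_derivative (transition d e) (at (snd d p)) \<circ>
      frechet_derivative (transition c d) (at (snd c p))) (at (snd c p))"
    using transition_has_derivative[OF c d] transition_has_derivative[OF d e]
    by (intro diff_chain_at) (simp_all add: transition_chart cd)
  then have "(transition c e has_derivative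
      frechet_derivative (transition d e) (at (snd d p)) \<circ>
      frechet_derivative (transition c d) (at (snd c p))) (at (snd c p))"
    by (rule has_derivative_transform_within_open[OF _ S]) (auto simp: transition_chart cd)
  from frechet_derivative_at[OF this] show ?thesis
    by (metis comp_apply)
qed

section \<open>Tangent vectors and their components\<close>

lemma tangent_spaceI:
  assumes "\<And>c d. c \<in> charts_at M p \<Longrightarrow> d \<in> charts_at M p \<Longrightarrow>
      \<xi> d = frechet_derivative (transition c d) (at (snd c p)) (\<xi> c)"
    and "\<And>c. c \<notin> charts_at M p \<Longrightarrow> \<xi> c = 0"
  shows "\<xi> \<in> tangent_space M p"
  using assms unfolding tangent_space_def by blast

lemma tangent_space_component:
  assumes "\<xi> \<in> tangent_space M p" and "c \<in> charts_at M p" and "d \<in> charts_at M p"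
  shows "\<xi> d = frechet_derivative (transition c d) (at (snd c p)) (\<xi> c)"
  using assms unfolding tangent_space_def by blast

lemma tangent_space_component_zero:
  assumes "\<xi> \<in> tangent_space M p" and "c \<notin> charts_at M p"
  shows "\<xi> c = 0"
  using assms unfolding tangent_space_def by blast

text \<open>Compatibility of the components in two charts is the cocycle identity.\<close>

lemma tvec_of_in_tangent_space:
  assumes "c \<in> charts_at M p"
  shows "tvec_of M c p v \<in> tangent_space M p"
  by (rule tangent_spaceI) (simp_all add: tvec_of_def frechet_transition_cocycle[OF assms])

text \<open>Hence \<open>tvec_of\<close> maps the model space onto the tangent space, which lets a
  claim about tangent vectors be checked on components in one chart.\<close>

lemma tvec_of_component:
  assumes "c \<in> charts_at M p" and "\<xi> \<in> tangent_space M p"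
  shows "tvec_of M c p (\<xi> c) = \<xi>"
  using tangent_space_component[OF assms(2,1), symmetric] tangent_space_component_zero[OF assms(2)]
  by (simp add: tvec_of_def fun_eq_iff)

lemma tscale_in_tangent_space:
  assumes "\<xi> \<in> tangent_space M p"
  shows "tscale a \<xi> \<in> tangent_space M p"
  by (rule tangent_spaceI)
    (simp_all add: tscale_def linear_cmul[OF linear_frechet_transition]
      tangent_space_component[OF assms, symmetric] tangent_space_component_zero[OF assms])

lemma tadd_in_tangent_space:
  assumes "\<xi> \<in> tangent_space M p" and "\<zeta> \<in> tangent_space M p"
  shows "tadd \<xi> \<zeta> \<in> tangent_space M p"
  by (rule tangent_spaceI)
    (simp_all add: tadd_def linear_add[OF linear_frechet_transition]
      tangent_space_component[OF assms(1), symmetric] tangent_space_component[OF assms(2), symmetric]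
      tangent_space_component_zero[OF assms(1)] tangent_space_component_zero[OF assms(2)])

section \<open>The differential and the chain rule along curves\<close>

lemma differential_tscale:
  assumes h: "differentiable_fun M h" and p: "p \<in> points M"
  shows "differential M h p (tscale a \<xi>) = a * differential M h p \<xi>"
proof -
  \<comment> \<open>This is the very chart selected inside \<open>differential\<close>, so no change
    of chart is needed.\<close>
  define c where "c = (SOME c. c \<in> charts_at M p)"
  have "c \<in> charts_at M p"
    unfolding c_def by (rule someI_ex) (use chart_at_exists[OF p] in blast)
  then have "(h \<circ> chart_inv c) differentiable (at (snd c p))"
    using h p by (auto simp: differentiable_fun_def)
  from linear_frechet_derivative[OF this] show ?thesis
    by (simp add: differential_def c_def[symmetric] Let_def tscale_def linear_cmul)
qed

text \<open>Chain rule for \<open>h \<circ> chart_inv c\<close> after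
  \<open>snd c \<circ> r\<close>. Derivatives are taken within \<open>S\<close>, so that endpoints
  of an interval are covered by one-sided derivatives.\<close>

lemma has_real_derivative_along_curve:
  assumes h: "differentiable_fun M h" and r: "differentiable_curve M S r" and t: "t \<in> S"
  shows "((h \<circ> r) has_real_derivative differential M h (r t) (velocity M S r t)) (at t within S)"
proof -
  have cont: "continuous_map (top_of_set S) (mtop M) r"
    and diff: "\<And>c. c \<in> charts_at M (r t) \<Longrightarrow> (snd c \<circ> r) differentiable (at t within S)"
    using r t by (auto simp: differentiable_curve_def)
  have p: "r t \<in> points M"
    using cont t by (auto simp: continuous_map_def)
  define c where "c = (SOME c. c \<in> charts_at M (r t))"
  have c: "c \<in> charts_at M (r t)"
    unfolding c_def by (rule someI_ex) (use chart_at_exists[OF p] in blast)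
  note cD = charts_atD[OF c]
  let ?f = "frechet_derivative (h \<circ> chart_inv c) (at (snd c (r t)))"
  let ?v = "vector_derivative (snd c \<circ> r) (at t within S)"
  have f: "((h \<circ> chart_inv c) has_derivative ?f) (at (snd c (r t)))"
    using h p c by (auto simp: differentiable_fun_def frechet_derivative_works)
  have "((snd c \<circ> r) has_derivative (\<lambda>y. y *\<^sub>R ?v)) (at t within S)"
    using diff[OF c] vector_derivative_works[of "snd c \<circ> r" "at t within S"]
    by (simp add: has_vector_derivative_def)
  then have "(((h \<circ> chart_inv c) \<circ> (snd c \<circ> r)) has_derivative ?f \<circ> (\<lambda>y. y *\<^sub>R ?v)) (at t within S)"
    by (rule diff_chain_within) (use f in \<open>auto intro: has_derivative_at_withinI\<close>)
  moreover have "?f \<circ> (\<lambda>y. y *\<^sub>R ?v) = (\<lambda>y. y * ?f ?v)"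
    using has_derivative_linear[OF f] by (auto simp: linear_cmul)
  moreover have "differential M h (r t) (velocity M S r t) = ?f ?v"
    using c by (simp add: differential_def c_def[symmetric] Let_def velocity_def)
  ultimately have chain: "(((h \<circ> chart_inv c) \<circ> (snd c \<circ> r)) has_derivative
      (\<lambda>y. y * differential M h (r t) (velocity M S r t))) (at t within S)"
    by simp
  \<comment> \<open>The factorisation through the chart equals \<open>h \<circ> r\<close> only while
    the curve is in the chart domain; continuity ensures this for times near
    \<open>t\<close>.\<close>
  have "openin (top_of_set S) {s \<in> S. r s \<in> fst c}"
    using openin_continuous_map_preimage[OF cont openin_chart_domain[OF cD(1)]] by simp
  then obtain U where U: "open U" "{s \<in> S. r s \<in> fst c} = S \<inter> U"
    by (auto simp: openin_open)
  then obtain e where e: "e > 0" "ball t e \<subseteq> U"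
    using t cD(2) open_contains_ball by blast
  have "((h \<circ> r) has_derivative (\<lambda>y. y * differential M h (r t) (velocity M S r t))) (at t within S)"
  proof (rule has_derivative_transform_within[OF chain e(1) t])
    fix s
    assume "s \<in> S" "dist s t < e"
    then have "s \<in> S \<inter> U"
      using e(2) by (auto simp: dist_commute)
    then have "r s \<in> fst c"
      unfolding U(2)[symmetric] by simp
    then show "((h \<circ> chart_inv c) \<circ> (snd c \<circ> r)) s = (h \<circ> r) s"
      by (simp add: chart_inv_chart cD)
  qed
  then show ?thesis
    by (simp add: has_real_derivative_iff_has_vector_derivative has_vector_derivative_def)
qed

end

section \<open>The gradient\<close>

lemma riemannian_manifold_imp_hilbert_manifold:
  "riemannian_manifold M \<Longrightarrow> hilbert_manifold M"
  by (simp add: riemannian_manifold_def)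

lemma inner_product_on_tangent_space:
  "riemannian_manifold M \<Longrightarrow> p \<in> points M \<Longrightarrow> inner_product_on (tangent_space M p) (metric M p)"
  by (simp add: riemannian_manifold_def)

section \<open>Norms of tangent vectors\<close>

lemma tnorm_tscale:
  assumes M: "riemannian_manifold M" and p: "p \<in> points M" and \<xi>: "\<xi> \<in> tangent_space M p"
  shows "tnorm M p (tscale a \<xi>) = \<bar>a\<bar> * tnorm M p \<xi>"
proof -
  have a\<xi>: "tscale a \<xi> \<in> tangent_space M p"
    using tscale_in_tangent_space[OF riemannian_manifold_imp_hilbert_manifold[OF M] \<xi>] .
  \<comment> \<open>Homogeneity is assumed in the first slot; symmetry transfers it to the
    second.\<close>
  have "metric M p (tscale a \<xi>) (tscale a \<xi>) = a * (a * metric M p \<xi> \<xi>)"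
    using inner_product_on_tangent_space[OF M p] \<xi> a\<xi> unfolding inner_product_on_def by metis
  then show ?thesis
    by (simp add: tnorm_def real_sqrt_mult mult.assoc[symmetric])
qed

text \<open>The real \<open>sqrt\<close> is negative at negative arguments, so the sign of the
  metric matters. Positivity is assumed for nonzero vectors; the zero vector is its own multiple by
  0.\<close>

lemma tnorm_nonneg:
  assumes M: "riemannian_manifold M" and p: "p \<in> points M" and \<xi>: "\<xi> \<in> tangent_space M p"
  shows "tnorm M p \<xi> \<ge> 0"
proof -
  have "metric M p \<xi> \<xi> \<ge> 0"
  proof (cases "\<xi> = (\<lambda>c. 0)")
    case True
    then have "tscale 0 \<xi> = \<xi>" by (simp add: tscale_def)
    then have "metric M p \<xi> \<xi> = 0 * metric M p \<xi> \<xi>"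
      using inner_product_on_tangent_space[OF M p] \<xi> unfolding inner_product_on_def by metis
    then show ?thesis by simp
  next
    case False
    then show ?thesis
      using inner_product_on_tangent_space[OF M p] \<xi> unfolding inner_product_on_def
      by (meson less_imp_le)
  qed
  then show ?thesis by (simp add: tnorm_def)
qed

text \<open>The definite description in \<open>gradient\<close> needs existence, from the Riesz
  theorem in a chart, and uniqueness, from positive definiteness.\<close>

lemma metric_gradient:
  fixes M :: "('p, 'e::{real_inner, complete_space}) riem"
  assumes M: "riemannian_manifold M" and h: "differentiable_fun M h"
    and p: "p \<in> points M" and \<xi>: "\<xi> \<in> tangent_space M p"
  shows "metric M p (gradient M h p) \<xi> = differential M h p \<xi>"
proof -
  note H = riemannian_manifold_imp_hilbert_manifold[OF M]
  let ?T = "tangent_space M p"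
  note ip = inner_product_on_tangent_space[OF M p]
  define c where "c = (SOME c. c \<in> charts_at M p)"
  have c: "c \<in> charts_at M p"
    unfolding c_def by (rule someI_ex) (use chart_at_exists[OF H p] in blast)
  note cD = charts_atD[OF c]
  note [simp] = chart_inv_chart[OF H cD]
  let ?x = "snd c p"
  let ?f = "frechet_derivative (h \<circ> chart_inv c) (at ?x)"
  have local: "local_metric M c ?x v w = metric M p (tvec_of M c p v) (tvec_of M c p w)" for v w
    by (simp add: local_metric_def)
  have xc: "?x \<in> snd c ` fst c" using cD by simp
  \<comment> \<open>The smooth local representative supplies boundedness of the bilinear form at
    \<open>?x\<close>; coercivity comes from the norm comparison below.\<close>
  obtain g :: "'e \<Rightarrow> 'e \<Rightarrow>\<^sub>L 'e \<Rightarrow>\<^sub>L real"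
    where g: "\<And>v w. blinfun_apply (blinfun_apply (g ?x) v) w = local_metric M c ?x v w"
    using M cD(1) xc unfolding riemannian_manifold_def by meson
  have "bounded_bilinear (\<lambda>v w. blinfun_apply (blinfun_apply (g ?x) v) w)"
    by (rule bounded_bilinear.comp1[OF bounded_bilinear_blinfun_apply blinfun.bounded_linear_right])
  then have bil: "bounded_bilinear (local_metric M c ?x)"
    by (simp add: g)
  have sym: "local_metric M c ?x v w = local_metric M c ?x w v" for v w
    using ip tvec_of_in_tangent_space[OF H c] by (simp add: local inner_product_on_def)
  obtain a where a: "a > 0" "\<And>v. a * (norm v)\<^sup>2 \<le> local_metric M c ?x v v"
    using M cD(1) xc unfolding riemannian_manifold_def by meson
  have "(h \<circ> chart_inv c) differentiable (at ?x)"
    using h p c by (auto simp: differentiable_fun_def)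
  then have "bounded_linear ?f"
    using frechet_derivative_works has_derivative_bounded_linear by blast
  from riesz_coercive[OF bil sym a this] obtain z where z: "\<And>w. local_metric M c ?x z w = ?f w"
    by blast
  let ?P = "\<lambda>\<zeta>. \<zeta> \<in> ?T \<and> (\<forall>\<xi>\<in>?T. metric M p \<zeta> \<xi> = differential M h p \<xi>)"
  have ex: "?P (tvec_of M c p z)"
  proof (intro conjI ballI)
    show "tvec_of M c p z \<in> ?T"
      by (rule tvec_of_in_tangent_space[OF H c])
    fix \<xi>
    assume "\<xi> \<in> ?T"
    from tvec_of_component[OF H c this] show "metric M p (tvec_of M c p z) \<xi> = differential M h p \<xi>"
      using z[of "\<xi> c"] by (simp add: local differential_def c_def[symmetric] Let_def)
  qed
  have unique: "\<zeta> = \<zeta>'" if \<zeta>: "?P \<zeta>" and \<zeta>': "?P \<zeta>'" for \<zeta> \<zeta>'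
  proof -
    let ?m = "tscale (- 1) \<zeta>'"
    \<comment> \<open>Both candidates have the same product with their difference \<open>?d\<close>,
      so \<open>?d\<close> is orthogonal to itself.\<close>
    let ?d = "tadd \<zeta> ?m"
    have m: "?m \<in> ?T" and d: "?d \<in> ?T"
      using \<zeta> \<zeta>' tscale_in_tangent_space[OF H] tadd_in_tangent_space[OF H] by auto
    have "metric M p ?d ?d = metric M p \<zeta> ?d + metric M p ?m ?d"
      using ip \<zeta> m d by (simp add: inner_product_on_def)
    also have "metric M p ?m ?d = - 1 * metric M p \<zeta>' ?d"
      using ip \<zeta>' d unfolding inner_product_on_def by blast
    finally have "metric M p ?d ?d = 0"
      using \<zeta> \<zeta>' d by simp
    then have "?d = (\<lambda>c. 0)"
      using ip d unfolding inner_product_on_def by (metis less_irrefl)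
    then show ?thesis
      by (simp add: tadd_def tscale_def fun_eq_iff)
  qed
  have "?P (gradient M h p)"
    unfolding gradient_def by (rule theI[of ?P, OF ex]) (rule unique[OF _ ex])
  then show ?thesis using \<xi> by blast
qed

section \<open>Monotonicity implies invexity\<close>

theorem theorem6:
  fixes M :: "('p, 'e::{real_inner, complete_space}) riem"
    and \<eta> :: "'p \<Rightarrow> 'p \<Rightarrow> ('p, 'e) tvec"
    and h :: "'p \<Rightarrow> real"
    and m :: nat
  assumes "riemannian_manifold M"
    and "geodesically_complete M"
    and "tangent_bifunction M \<eta>"
    and "m \<ge> 1"
    and "differentiable_fun M h"
    and "integrable_bifunction M \<eta>"
    and "strongly_invariant_monotone M \<eta> m (gradient M h)"
  shows "strongly_invex M \<eta> m h"
proof -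
  note M = assms(1) and \<eta> = assms(3) and m = assms(4) and h = assms(5)
  note H = riemannian_manifold_imp_hilbert_manifold[OF M]
  from assms(7) obtain \<delta> where \<delta>: "\<delta> > 0"
    and mono: "\<And>u v. u \<in> points M \<Longrightarrow> v \<in> points M \<Longrightarrow>
      metric M v (gradient M h v) (\<eta> u v) + metric M u (gradient M h u) (\<eta> v u)
        \<le> - \<delta> * (tnorm M v (\<eta> u v) ^ m + tnorm M u (\<eta> v u) ^ m)"
    unfolding strongly_invariant_monotone_def by blast
  have T: "\<eta> u v \<in> tangent_space M v" if "u \<in> points M" "v \<in> points M" for u v
    using \<eta> that by (simp add: tangent_bifunction_def)
  have "h u \<ge> h v + differential M h v (\<eta> u v) + \<delta> / m * tnorm M v (\<eta> u v) ^ m"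
    if u: "u \<in> points M" and v: "v \<in> points M" for u v
  proof -
    obtain r where P: "property_P M \<eta> r v u"
      using assms(6) u v unfolding integrable_bifunction_def by blast
    then have curve: "differentiable_curve M {0..1} r" and ends: "r 0 = v" "r 1 = u"
      by (auto simp: property_P_def)
    define V where "V = velocity M {0..1} r"
    have V: "tscale (s - t) (V t) = \<eta> (r s) (r t)" if "s \<in> {0..1}" "t \<in> {0..1}" for s t
      using P that by (simp add: property_P_def V_def)
    have r: "r t \<in> points M" if "t \<in> {0..1}" for t
      using curve that by (auto simp: differentiable_curve_def continuous_map_def)
    define D where "D t = differential M h (r t) (V t)" for t
    define N where "N = tnorm M v (\<eta> u v)"
    have \<eta>V: "\<eta> u v = V 0"
      using V[of 1 0] ends by (simp add: tscale_def)
    have V0: "V 0 \<in> tangent_space M v"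
      using T[OF u v] by (simp add: \<eta>V)
    have D_mono: "D s \<ge> D 0 + \<delta> * N ^ m * s ^ (m - 1)" if s: "0 < s" "s < 1" for s
    proof -
      have rs: "r s \<in> points M" using r s by simp
      \<comment> \<open>Property (P) turns \<open>\<eta> (r b) (r a)\<close> into a multiple of the
        velocity. The pairs of times 0, \<open>s\<close> and \<open>s\<close>, 0 give
        \<open>s * D 0\<close> and \<open>- s * D s\<close>.\<close>
      have grad: "metric M (r a) (gradient M h (r a)) (\<eta> (r b) (r a)) = (b - a) * D a"
        if "a \<in> {0..1}" "b \<in> {0..1}" for a b
        using that metric_gradient[OF M h r T[OF r r]] differential_tscale[OF H h r]
        by (simp add: V[symmetric] D_def)
      \<comment> \<open>The norm at \<open>r s\<close> is discarded by its sign; only the norm at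
        \<open>v\<close> enters the bound.\<close>
      have "tnorm M (r s) (\<eta> v (r s)) ^ m \<ge> 0"
        using tnorm_nonneg[OF M rs T[OF v rs]] by simp
      moreover have "tnorm M v (\<eta> (r s) v) = s * N"
        using V[of s 0] s tnorm_tscale[OF M v V0, of s] by (simp add: ends N_def \<eta>V)
      moreover have "s * D 0 - s * D s
          \<le> - \<delta> * (tnorm M v (\<eta> (r s) v) ^ m + tnorm M (r s) (\<eta> v (r s)) ^ m)"
        using mono[OF rs v] grad[of 0 s] grad[of s 0] s by (simp add: ends)
      ultimately have "s * D 0 - s * D s \<le> - \<delta> * (s * N) ^ m"
        using \<delta> by (simp add: distrib_left) (smt (verit, best) mult_nonneg_nonneg)
      also have "(s * N) ^ m = s * (N ^ m * s ^ (m - 1))"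
        using m by (cases m) (simp_all add: power_mult_distrib)
      finally have "s * (D 0 + \<delta> * N ^ m * s ^ (m - 1)) \<le> s * D s"
        by (simp add: algebra_simps)
      then show ?thesis using s by simp
    qed
    \<comment> \<open>The factor \<open>1 / m\<close> cancels the \<open>m\<close> from
      differentiating \<open>s ^ m\<close>, so that \<open>D_mono\<close> says
      \<open>F' s \<ge> 0\<close> for \<open>0 < s < 1\<close>.\<close>
    define F where "F s = h (r s) - D 0 * s - \<delta> / m * N ^ m * s ^ m" for s
    define F' where "F' s = D s - D 0 - \<delta> * N ^ m * s ^ (m - 1)" for s
    have F: "(F has_real_derivative F' s) (at s within {0..1})" if "s \<in> {0..1}" for s
    proof -
      have [derivative_intros]: "((\<lambda>s. h (r s)) has_real_derivative D s) (at s within {0..1})"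
        using has_real_derivative_along_curve[OF H h curve that] by (simp add: o_def D_def V_def)
      show ?thesis
        unfolding F_def F'_def using m by (auto intro!: derivative_eq_intros)
    qed
    obtain s where s: "s \<in> {0<..<1}" "F 1 - F 0 = F' s * (1 - 0)"
      using mvt_simple[of 0 1 F "\<lambda>s y. F' s * y"] F by (auto simp: has_field_derivative_def)
    have "F 1 - F 0 \<ge> 0"
      using s D_mono[of s] by (simp add: F'_def)
    \<comment> \<open>Since \<open>m \<ge> 1\<close>, the power \<open>0 ^ m\<close> vanishes and
      \<open>F 0 = h v\<close>.\<close>
    then show ?thesis
      using m by (simp add: F_def N_def D_def ends \<eta>V zero_power)
  qed
  moreover have "\<delta> / m > 0" using \<delta> m by simp
  ultimately show ?thesis
    unfolding strongly_invex_def by blast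
qed

end
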